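(* Let $k\ge 1$, let $z_1,\dots,z_k\in\mathbb{C}$ be pairwise distinct, let $h_1,\dots,h_k\in\mathbb{C}$, and let $w_1,\dots,w_k\in\mathbb{C}$ with $w_i\neq 0$ for all $i$. Let $$N(s)=\sum_{i=1}^k \frac{w_i h_i}{s-z_i},\qquad D(s)=\sum_{i=1}^k\frac{w_i}{s-z_i},\qquad \hat H(s)=\frac{N(s)}{D(s)},$$ and write $N(s)=\frac{p(s)}{l(s)}$ and $D(s)=\frac{q(s)}{l(s)}$, where $l(s)=\prod_{i=1}^k (s-z_i)$ and $p(s),q(s)$ are polynomials in $s$, so that $\hat H(s)=\frac{p(s)}{q(s)}$. Then the following statements hold. 1. If $D(s)$ is Minimum Phase, then $\hat H(s)$ is asymptotically stable. 2. If the polynomials $p(s)$ and $q(s)$ share no roots in the closed right-half complex plane $\{s:\mathrm{Re}(s)\ge 0\}$, then the poles of $\hat H(s)$ are asymptotically stable if and only if $D(s)$ is Minimum Phase.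
   Context: A rational function $F(s)=f_1(s)/f_2(s)$, with $f_1,f_2$ coprime polynomials, is called Minimum Phase if $f_1(s)\neq 0$ for all $s\in\mathbb{C}$ with $\mathrm{Re}(s)\geq 0$. A pole of a rational function is asymptotically stable if it has strictly negative real part; a rational function is asymptotically stable if all its poles (after cancellation of common factors of numerator and denominator) have strictly negative real part. *)

theory Defs
  imports
    Complex_Main
    "HOL-Computational_Algebra.Polynomial"
    "HOL-Computational_Algebra.Fraction_Field"
begin

text \<open>
  Rational functions in one complex variable are elements of the fraction field of the
  polynomial ring over the complex numbers, i.e. of type \<open>complex poly fract\<close>.
\<close>

definition reduced_form :: "complex poly fract \<Rightarrow> complex poly \<Rightarrow> complex poly \<Rightarrow> bool" where
  "reduced_form F f1 f2 \<longleftrightarrow> f2 \<noteq> 0 \<and> coprime f1 f2 \<and> F = Fract f1 f2"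

text \<open>
  Every rational function has a reduced form, unique up to a common nonzero constant factor.
  Since such a factor does not change the roots, it is immaterial below whether reduced forms
  are quantified existentially or universally.
\<close>

definition minimum_phase :: "complex poly fract \<Rightarrow> bool" where
  "minimum_phase F \<longleftrightarrow>
     (\<exists>f1 f2. reduced_form F f1 f2 \<and> (\<forall>s. Re s \<ge> 0 \<longrightarrow> poly f1 s \<noteq> 0))"

definition rat_pole :: "complex poly fract \<Rightarrow> complex \<Rightarrow> bool" where
  "rat_pole F s \<longleftrightarrow> (\<exists>f1 f2. reduced_form F f1 f2 \<and> poly f2 s = 0)"

definition asymptotically_stable :: "complex poly fract \<Rightarrow> bool" where
  "asymptotically_stable F \<longleftrightarrow> (\<forall>s. rat_pole F s \<longrightarrow> Re s < 0)"

end

theory Submission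
  imports
    Defs
    "HOL-Computational_Algebra.Fundamental_Theorem_Algebra"
    "HOL-Computational_Algebra.Field_as_Ring"
    "HOL-Computational_Algebra.Polynomial_Factorial"
begin

text \<open>
  Clearing denominators gives \<open>q = (\<Sum>i. w i * (\<Prod>j\<noteq>i. (s - z j)))\<close>, and so
  \<open>q (z i) = w i * (\<Prod>j\<noteq>i. (z i - z j)) \<noteq> 0\<close> because the nodes are distinct and
  the weights are nonzero. Hence \<open>q\<close> and \<open>l\<close> have no common root: the fraction \<open>q / l\<close> is already
  reduced, and \<open>D\<close> is minimum phase iff \<open>q\<close> has no root in the closed right half plane
  (\<open>minimum_phase_Fract_iff\<close>).

  On the other side \<open>H = p / q\<close>, so the poles of \<open>H\<close> are roots of \<open>q\<close>
  (\<open>rat_pole_Fract_imp_root\<close>), which is the first claim. Conversely a root of \<open>q\<close> at which \<open>p\<close> does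
  not vanish survives cancellation and is a pole (\<open>rat_pole_Fract\<close>). If \<open>p\<close> and \<open>q\<close> share no root in
  the closed right half plane, then the poles of \<open>H\<close> there are exactly the roots of \<open>q\<close> there, which
  is the second claim.
\<close>

lemma coprime_poly_if_no_common_root:
  fixes f g :: "complex poly"
  assumes "g \<noteq> 0" and no_root: "\<And>s. poly f s = 0 \<Longrightarrow> poly g s \<noteq> 0"
  shows "coprime f g"
proof (rule coprimeI)
  fix d assume d: "d dvd f" "d dvd g"
  have "constant (poly d)"
  proof (rule ccontr)
    assume "\<not> constant (poly d)"
    then obtain s where "poly d s = 0"
      using fundamental_theorem_of_algebra by blast
    then show False
      using d no_root[of s] by (auto elim!: dvdE)
  qed
  moreover have "d \<noteq> 0"
    using d(2) \<open>g \<noteq> 0\<close> by auto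
  ultimately show "is_unit d"
    by (simp add: constant_degree is_unit_iff_degree)
qed

lemma reduced_form_exists:
  assumes "g \<noteq> 0"
  obtains f' g' where "reduced_form (Fract f g) f' g'"
proof -
  have "gcd f g \<noteq> 0"
    using assms by simp
  then obtain f' g' where fg: "f = f' * gcd f g" "g = g' * gcd f g" "coprime f' g'"
    using gcd_coprime_exists[of f g] by auto
  have "g' \<noteq> 0"
    using fg(2) assms by auto
  moreover have "f * g' = f' * g"
    by (subst fg(1), subst (2) fg(2)) (simp add: mult_ac)
  ultimately have "reduced_form (Fract f g) f' g'"
    using assms fg(3) by (simp add: reduced_form_def eq_fract)
  then show thesis
    by (rule that)
qed

lemma reduced_form_Fract_cross_mult:
  assumes "g \<noteq> 0" and "reduced_form (Fract f g) f' g'"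
  shows "poly f s * poly g' s = poly f' s * poly g s"
proof -
  have "f * g' = f' * g"
    using assms by (auto simp: reduced_form_def eq_fract(1))
  then show ?thesis
    by (metis poly_mult)
qed

lemma minimum_phase_Fract_iff:
  assumes "g \<noteq> 0" and no_root: "\<And>s. poly f s = 0 \<Longrightarrow> poly g s \<noteq> 0"
  shows "minimum_phase (Fract f g) \<longleftrightarrow> (\<forall>s. Re s \<ge> 0 \<longrightarrow> poly f s \<noteq> 0)"
proof
  assume "minimum_phase (Fract f g)"
  then obtain f' g' where red: "reduced_form (Fract f g) f' g'"
    and f': "\<forall>s. Re s \<ge> 0 \<longrightarrow> poly f' s \<noteq> 0"
    by (auto simp: minimum_phase_def)
  show "\<forall>s. Re s \<ge> 0 \<longrightarrow> poly f s \<noteq> 0"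
    using reduced_form_Fract_cross_mult[OF \<open>g \<noteq> 0\<close> red] f' no_root
    by (metis mult_eq_0_iff)
next
  assume "\<forall>s. Re s \<ge> 0 \<longrightarrow> poly f s \<noteq> 0"
  moreover have "reduced_form (Fract f g) f g"
    using assms coprime_poly_if_no_common_root by (auto simp: reduced_form_def)
  ultimately show "minimum_phase (Fract f g)"
    by (auto simp: minimum_phase_def)
qed

lemma rat_pole_Fract_imp_root:
  assumes "g \<noteq> 0" and "rat_pole (Fract f g) s"
  shows "poly g s = 0"
proof -
  obtain f' g' where red: "reduced_form (Fract f g) f' g'" and "poly g' s = 0"
    using assms(2) by (auto simp: rat_pole_def)
  moreover have "poly f' s \<noteq> 0"
    using red \<open>poly g' s = 0\<close> coprime_poly_0[of f' g' s] by (auto simp: reduced_form_def)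
  ultimately show ?thesis
    using reduced_form_Fract_cross_mult[OF \<open>g \<noteq> 0\<close> red, of s] by simp
qed

lemma rat_pole_Fract:
  assumes "g \<noteq> 0" "poly g s = 0" "poly f s \<noteq> 0"
  shows "rat_pole (Fract f g) s"
proof -
  obtain f' g' where red: "reduced_form (Fract f g) f' g'"
    using reduced_form_exists[OF \<open>g \<noteq> 0\<close>] .
  then have "poly g' s = 0"
    using reduced_form_Fract_cross_mult[OF \<open>g \<noteq> 0\<close> red, of s] assms by simp
  with red show ?thesis
    by (auto simp: rat_pole_def)
qed

lemma sum_Fract_same_denominator:
  fixes d :: "'a::idom"
  assumes "finite A" "d \<noteq> 0"
  shows "(\<Sum>i\<in>A. Fract (f i) d) = Fract (\<Sum>i\<in>A. f i) d"
  using assms(1)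
proof (induction A rule: finite_induct)
  case empty
  then show ?case
    using assms(2) by (simp add: Zero_fract_def eq_fract)
next
  case (insert i A)
  then show ?case
    using assms(2) by (simp add: eq_fract algebra_simps)
qed

lemma sum_simple_Fract:
  fixes z c :: "'i \<Rightarrow> 'a::idom"
  assumes "finite A"
  shows "(\<Sum>i\<in>A. Fract [:c i:] [:- z i, 1:]) =
    Fract (\<Sum>i\<in>A. [:c i:] * (\<Prod>j\<in>A - {i}. [:- z j, 1:])) (\<Prod>i\<in>A. [:- z i, 1:])"
proof -
  have nz: "(\<Prod>i\<in>A. [:- z i, 1:]) \<noteq> 0"
    using assms by simp
  have "Fract [:c i:] [:- z i, 1:] =
      Fract ([:c i:] * (\<Prod>j\<in>A - {i}. [:- z j, 1:])) (\<Prod>i\<in>A. [:- z i, 1:])" if "i \<in> A" for i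
  proof -
    have "(\<Prod>i\<in>A. [:- z i, 1:]) = [:- z i, 1:] * (\<Prod>j\<in>A - {i}. [:- z j, 1:])"
      using assms that by (rule prod.remove)
    then have "[:c i:] * (\<Prod>i\<in>A. [:- z i, 1:]) =
        ([:c i:] * (\<Prod>j\<in>A - {i}. [:- z j, 1:])) * [:- z i, 1:]"
      by (simp only: mult_ac)
    then show ?thesis
      using nz by (subst eq_fract) auto
  qed
  then show ?thesis
    using sum_Fract_same_denominator[OF assms nz] by simp
qed

lemma poly_simple_Fract_numerator:
  fixes z c :: "'i \<Rightarrow> 'a::idom"
  assumes "finite A" "m \<in> A"
  shows "poly (\<Sum>i\<in>A. [:c i:] * (\<Prod>j\<in>A - {i}. [:- z j, 1:])) (z m) =
    c m * (\<Prod>j\<in>A - {m}. z m - z j)"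
proof -
  have "poly (\<Sum>i\<in>A. [:c i:] * (\<Prod>j\<in>A - {i}. [:- z j, 1:])) (z m) =
      (\<Sum>i\<in>A. c i * (\<Prod>j\<in>A - {i}. z m - z j))"
    by (simp add: poly_sum poly_prod)
  also have "\<dots> = (\<Sum>i\<in>A. if i = m then c m * (\<Prod>j\<in>A - {m}. z m - z j) else 0)"
    using assms by (intro sum.cong) auto
  also have "\<dots> = c m * (\<Prod>j\<in>A - {m}. z m - z j)"
    using assms by simp
  finally show ?thesis .
qed

theorem proposition4p1:
  fixes k :: nat
    and z h w :: "nat \<Rightarrow> complex"
    and N D H :: "complex poly fract"
    and l p q :: "complex poly"
  assumes "k \<ge> 1"
    and "inj_on z {1..k}"
    and "\<And>i. i \<in> {1..k} \<Longrightarrow> w i \<noteq> 0"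
    and "N = (\<Sum>i\<in>{1..k}. Fract [:w i * h i:] [:- z i, 1:])"
    and "D = (\<Sum>i\<in>{1..k}. Fract [:w i:] [:- z i, 1:])"
    and "H = N / D"
    and "l = (\<Prod>i\<in>{1..k}. [:- z i, 1:])"
    and "N = Fract p l"
    and "D = Fract q l"
  shows "(minimum_phase D \<longrightarrow> asymptotically_stable H) \<and>
         ((\<nexists>s. Re s \<ge> 0 \<and> poly p s = 0 \<and> poly q s = 0) \<longrightarrow>
            (asymptotically_stable H \<longleftrightarrow> minimum_phase D))"
proof -
  have l_nz: "l \<noteq> 0"
    using assms(7) by simp
  have "Fract q l = Fract (\<Sum>i\<in>{1..k}. [:w i:] * (\<Prod>j\<in>{1..k} - {i}. [:- z j, 1:])) l"
    using assms(5,7,9) sum_simple_Fract[of "{1..k}" w z] by simp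
  then have q: "q = (\<Sum>i\<in>{1..k}. [:w i:] * (\<Prod>j\<in>{1..k} - {i}. [:- z j, 1:]))"
    using l_nz by (simp only: eq_fract(1)[OF l_nz l_nz] mult_cancel_right) blast
  have q_node: "poly q (z i) \<noteq> 0" if i: "i \<in> {1..k}" for i
  proof -
    have "z i - z j \<noteq> 0" if "j \<in> {1..k} - {i}" for j
      using that i \<open>inj_on z {1..k}\<close> by (auto dest: inj_onD)
    then have "(\<Prod>j\<in>{1..k} - {i}. z i - z j) \<noteq> 0"
      by simp
    then show ?thesis
      using assms(3)[OF i] poly_simple_Fract_numerator[of "{1..k}" i w z] i by (simp add: q)
  qed
  have "poly q s \<noteq> 0" if "poly l s = 0" for s
    using that q_node assms(7) by (auto simp: poly_prod)
  then have mp: "minimum_phase D \<longleftrightarrow> (\<forall>s. Re s \<ge> 0 \<longrightarrow> poly q s \<noteq> 0)"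
    using minimum_phase_Fract_iff[OF l_nz, of q] assms(9) by auto
  \<comment> \<open>Since \<open>k \<ge> 1\<close> there is a node, and \<open>q\<close> does not vanish there.\<close>
  have q_nz: "q \<noteq> 0"
    using q_node[of 1] \<open>k \<ge> 1\<close> by auto
  have H: "H = Fract p q"
    using assms(6,8,9) l_nz q_nz by (simp add: eq_fract mult_ac)
  show ?thesis
  proof (intro conjI impI)
    assume "minimum_phase D"
    then show "asymptotically_stable H"
      using rat_pole_Fract_imp_root[OF q_nz] mp H
      by (auto simp: asymptotically_stable_def not_le[symmetric])
  next
    assume no_common: "\<nexists>s. Re s \<ge> 0 \<and> poly p s = 0 \<and> poly q s = 0"
    have "rat_pole H s \<longleftrightarrow> poly q s = 0" if "Re s \<ge> 0" for s
      using that no_common rat_pole_Fract[OF q_nz] rat_pole_Fract_imp_root[OF q_nz] H by blast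
    then show "asymptotically_stable H \<longleftrightarrow> minimum_phase D"
      unfolding asymptotically_stable_def mp by (meson not_le)
  qed
qed

end
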